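(* Let $R$ be a commutative perfect ring. Then any automorphism-coinvariant module over $R$ is quasi-projective.
   Context: Rings have an identity and modules are unitary. Over a perfect ring every module $M$ has a projective cover $\pi:P\to M$. The module $M$ is automorphism-coinvariant (respectively quasi-projective) if for every automorphism (respectively endomorphism) $g$ of $P$ there is an endomorphism $f$ of $M$ with $\pi\circ g=f\circ\pi$. *)

theory Defs
  imports "HOL-Algebra.Algebra"
begin

section \<open>Commutative perfect rings\<close>

definition jacobson_radical :: "('r, 's) ring_scheme \<Rightarrow> 'r set" where
  "jacobson_radical R = {x \<in> carrier R. \<forall>I. maximalideal I R \<longrightarrow> x \<in> I}"

text \<open>A commutative ring is semisimple if it is semisimple as a module over itself, that is, if every
  submodule (= ideal) is a direct summand. The zero ring counts as semisimple.\<close>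

definition semisimple_cring :: "('r, 's) ring_scheme \<Rightarrow> bool" where
  "semisimple_cring R \<longleftrightarrow> cring R \<and>
     (\<forall>I. ideal I R \<longrightarrow>
        (\<exists>I'. ideal I' R \<and> I <+>\<^bsub>R\<^esub> I' = carrier R \<and> I \<inter> I' = {\<zero>\<^bsub>R\<^esub>}))"

definition T_nilpotent :: "('r, 's) ring_scheme \<Rightarrow> 'r set \<Rightarrow> bool" where
  "T_nilpotent R J \<longleftrightarrow>
     (\<forall>a :: nat \<Rightarrow> 'r. (\<forall>i. a i \<in> J) \<longrightarrow> (\<exists>n. (\<Otimes>\<^bsub>R\<^esub>i\<in>{..n}. a i) = \<zero>\<^bsub>R\<^esub>))"

text \<open>Perfect rings are defined as in Lam's \<^emph>\<open>First Course in Noncommutative Rings\<close>, Definition 23.1: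
  the quotient by the Jacobson radical is semisimple and the radical is T-nilpotent. By Bass's
  Theorem P this holds iff every module has a projective cover; that form quantifies over modules on
  arbitrary carrier types and so is not available as a definition in HOL.\<close>

definition perfect_cring :: "('r, 's) ring_scheme \<Rightarrow> bool" where
  "perfect_cring R \<longleftrightarrow> cring R \<and>
     semisimple_cring (R Quot jacobson_radical R) \<and> T_nilpotent R (jacobson_radical R)"


section \<open>Homomorphisms, projective modules and projective covers\<close>

text \<open>Homomorphisms are functions on the whole type of which only the values on the carrier of the
  domain matter; equations between homomorphisms are therefore stated on carriers.\<close>

definition mod_hom ::
  "('r, 's) ring_scheme \<Rightarrow> ('r, 'm) module \<Rightarrow> ('r, 'n) module \<Rightarrow> ('m \<Rightarrow> 'n) set" where
  "mod_hom R M N = {f \<in> hom (add_monoid M) (add_monoid N).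
     \<forall>a \<in> carrier R. \<forall>x \<in> carrier M. f (a \<odot>\<^bsub>M\<^esub> x) = a \<odot>\<^bsub>N\<^esub> f x}"

definition mod_aut :: "('r, 's) ring_scheme \<Rightarrow> ('r, 'm) module \<Rightarrow> ('m \<Rightarrow> 'm) set" where
  "mod_aut R M = {g \<in> mod_hom R M M. bij_betw g (carrier M) (carrier M)}"

definition mod_epi ::
  "('r, 's) ring_scheme \<Rightarrow> ('r, 'm) module \<Rightarrow> ('r, 'n) module \<Rightarrow> ('m \<Rightarrow> 'n) set" where
  "mod_epi R M N = {p \<in> mod_hom R M N. p ` carrier M = carrier N}"

text \<open>Projectivity is the lifting property. A definition has to fix the carrier types of the test
  modules \<open>A\<close> and \<open>B\<close>; the types below admit \<open>B = P\<close> and the free module on the carrier of \<open>P\<close>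
  as \<open>A\<close>. This suffices for lifting along epimorphisms between modules of any types: see
  \<open>projective_module_lift\<close>.\<close>

definition projective_module ::
  "('r, 's) ring_scheme \<Rightarrow> ('r, 'p) module \<Rightarrow> bool" where
  "projective_module R P \<longleftrightarrow> module R P \<and>
     (\<forall>(A :: ('r, 'p \<Rightarrow> 'r) module) (B :: ('r, 'p) module). \<forall>p \<in> mod_epi R A B. \<forall>f \<in> mod_hom R P B.
        module R A \<longrightarrow> module R B \<longrightarrow>
        (\<exists>h \<in> mod_hom R P A. \<forall>x \<in> carrier P. p (h x) = f x))"

definition superfluous_submodule ::
  "'p set \<Rightarrow> ('r, 's) ring_scheme \<Rightarrow> ('r, 'p) module \<Rightarrow> bool" where
  "superfluous_submodule K R P \<longleftrightarrow> submodule K R P \<and>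
     (\<forall>N. submodule N R P \<longrightarrow> K <+>\<^bsub>P\<^esub> N = carrier P \<longrightarrow> N = carrier P)"

definition projective_cover ::
  "('r, 's) ring_scheme \<Rightarrow> ('r, 'p) module \<Rightarrow> ('p \<Rightarrow> 'm) \<Rightarrow> ('r, 'm) module \<Rightarrow> bool" where
  "projective_cover R P \<pi> M \<longleftrightarrow> module R M \<and> projective_module R P \<and> \<pi> \<in> mod_epi R P M \<and>
     superfluous_submodule {x \<in> carrier P. \<pi> x = \<zero>\<^bsub>M\<^esub>} R P"


section \<open>Automorphism-coinvariant and quasi-projective modules\<close>

text \<open>Both notions are properties of \<open>M\<close> expressed through its projective cover \<open>\<pi> : P \<rightarrow> M\<close>, which is
  unique up to isomorphism over \<open>M\<close>; the cover is passed explicitly so that \<open>P\<close> may live on any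
  type.\<close>

definition automorphism_coinvariant ::
  "('r, 's) ring_scheme \<Rightarrow> ('r, 'p) module \<Rightarrow> ('p \<Rightarrow> 'm) \<Rightarrow> ('r, 'm) module \<Rightarrow> bool" where
  "automorphism_coinvariant R P \<pi> M \<longleftrightarrow>
     (\<forall>g \<in> mod_aut R P. \<exists>f \<in> mod_hom R M M. \<forall>x \<in> carrier P. \<pi> (g x) = f (\<pi> x))"

definition quasi_projective ::
  "('r, 's) ring_scheme \<Rightarrow> ('r, 'p) module \<Rightarrow> ('p \<Rightarrow> 'm) \<Rightarrow> ('r, 'm) module \<Rightarrow> bool" where
  "quasi_projective R P \<pi> M \<longleftrightarrow>
     (\<forall>g \<in> mod_hom R P P. \<exists>f \<in> mod_hom R M M. \<forall>x \<in> carrier P. \<pi> (g x) = f (\<pi> x))"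


section \<open>Lifting along epimorphisms of arbitrary type\<close>

lemma mod_homI:
  assumes "\<And>x. x \<in> carrier M \<Longrightarrow> f x \<in> carrier N"
    and "\<And>x y. x \<in> carrier M \<Longrightarrow> y \<in> carrier M \<Longrightarrow> f (x \<oplus>\<^bsub>M\<^esub> y) = f x \<oplus>\<^bsub>N\<^esub> f y"
    and "\<And>a x. a \<in> carrier R \<Longrightarrow> x \<in> carrier M \<Longrightarrow> f (a \<odot>\<^bsub>M\<^esub> x) = a \<odot>\<^bsub>N\<^esub> f x"
  shows "f \<in> mod_hom R M N"
  using assms by (auto simp: mod_hom_def hom_def)

lemma mod_homD:
  assumes "f \<in> mod_hom R M N"
  shows "\<And>x. x \<in> carrier M \<Longrightarrow> f x \<in> carrier N"
    and "\<And>x y. x \<in> carrier M \<Longrightarrow> y \<in> carrier M \<Longrightarrow> f (x \<oplus>\<^bsub>M\<^esub> y) = f x \<oplus>\<^bsub>N\<^esub> f y"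
    and "\<And>a x. a \<in> carrier R \<Longrightarrow> x \<in> carrier M \<Longrightarrow> f (a \<odot>\<^bsub>M\<^esub> x) = a \<odot>\<^bsub>N\<^esub> f x"
  using assms by (auto simp: mod_hom_def hom_def Pi_def)

lemma mod_hom_finsum:
  assumes M: "module R M" and N: "module R N" and f: "f \<in> mod_hom R M N"
    and S: "finite S" and u: "u \<in> S \<rightarrow> carrier M"
  shows "f (\<Oplus>\<^bsub>M\<^esub>i\<in>S. u i) = (\<Oplus>\<^bsub>N\<^esub>i\<in>S. f (u i))"
proof -
  interpret M: module R M by fact
  interpret N: module R N by fact
  note D = mod_homD[OF f]
  have z: "f \<zero>\<^bsub>M\<^esub> = \<zero>\<^bsub>N\<^esub>"
    using D(3)[of "\<zero>\<^bsub>R\<^esub>" "\<zero>\<^bsub>M\<^esub>"] D(1)[of "\<zero>\<^bsub>M\<^esub>"] by simp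
  from S u show ?thesis
    by (induct S) (use z D in \<open>auto simp: Pi_def\<close>)
qed

definition free_module :: "('r, 's) ring_scheme \<Rightarrow> 'x set \<Rightarrow> ('r, 'x \<Rightarrow> 'r) module" where
  "free_module R Y =
     \<lparr>carrier = {u. (\<forall>x. u x \<in> carrier R) \<and> {x. u x \<noteq> \<zero>\<^bsub>R\<^esub>} \<subseteq> Y \<and> finite {x. u x \<noteq> \<zero>\<^bsub>R\<^esub>}},
      monoid.mult = undefined, one = undefined,
      ring.zero = (\<lambda>_. \<zero>\<^bsub>R\<^esub>), add = (\<lambda>u v x. u x \<oplus>\<^bsub>R\<^esub> v x),
      smult = (\<lambda>a u x. a \<otimes>\<^bsub>R\<^esub> u x)\<rparr>"

lemma module_free_module:
  assumes "cring R"
  shows "module R (free_module R Y)"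
proof -
  interpret cring R by fact
  have add: "(\<lambda>x. u x \<oplus>\<^bsub>R\<^esub> v x) \<in> carrier (free_module R Y)"
    if "u \<in> carrier (free_module R Y)" "v \<in> carrier (free_module R Y)" for u v
  proof -
    have "{x. u x \<oplus>\<^bsub>R\<^esub> v x \<noteq> \<zero>\<^bsub>R\<^esub>} \<subseteq> {x. u x \<noteq> \<zero>\<^bsub>R\<^esub>} \<union> {x. v x \<noteq> \<zero>\<^bsub>R\<^esub>}" by auto
    with that show ?thesis
      by (auto simp: free_module_def intro: finite_subset)
  qed
  have smult: "(\<lambda>x. a \<otimes>\<^bsub>R\<^esub> u x) \<in> carrier (free_module R Y)"
    if "u \<in> carrier (free_module R Y)" "a \<in> carrier R" for a u
  proof -
    have "{x. a \<otimes>\<^bsub>R\<^esub> u x \<noteq> \<zero>\<^bsub>R\<^esub>} \<subseteq> {x. u x \<noteq> \<zero>\<^bsub>R\<^esub>}" using that by auto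
    with that show ?thesis
      by (auto simp: free_module_def intro: finite_subset)
  qed
  have minus: "\<exists>v \<in> carrier (free_module R Y). (\<lambda>x. v x \<oplus>\<^bsub>R\<^esub> u x) = (\<lambda>_. \<zero>\<^bsub>R\<^esub>)"
    if "u \<in> carrier (free_module R Y)" for u
  proof (rule bexI[of _ "\<lambda>x. \<ominus>\<^bsub>R\<^esub> \<one>\<^bsub>R\<^esub> \<otimes>\<^bsub>R\<^esub> u x"])
    show "(\<lambda>x. \<ominus>\<^bsub>R\<^esub> \<one>\<^bsub>R\<^esub> \<otimes>\<^bsub>R\<^esub> u x) \<in> carrier (free_module R Y)" using smult[OF that] by simp
    show "(\<lambda>x. \<ominus>\<^bsub>R\<^esub> \<one>\<^bsub>R\<^esub> \<otimes>\<^bsub>R\<^esub> u x \<oplus>\<^bsub>R\<^esub> u x) = (\<lambda>_. \<zero>\<^bsub>R\<^esub>)"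
      using that by (auto simp: free_module_def l_minus l_neg)
  qed
  show ?thesis
  proof (rule moduleI)
    show "abelian_group (free_module R Y)"
    proof (rule abelian_groupI)
      show "\<And>u. u \<in> carrier (free_module R Y) \<Longrightarrow>
          \<exists>v\<in>carrier (free_module R Y). v \<oplus>\<^bsub>free_module R Y\<^esub> u = \<zero>\<^bsub>free_module R Y\<^esub>"
        using minus by (simp add: free_module_def)
    qed (use add in \<open>auto simp: free_module_def a_ac\<close>)
  qed (use assms smult in \<open>auto simp: free_module_def l_distr r_distr m_assoc\<close>)
qed

definition free_extension ::
  "('r, 's) ring_scheme \<Rightarrow> ('r, 'm) module \<Rightarrow> ('x \<Rightarrow> 'm) \<Rightarrow> ('x \<Rightarrow> 'r) \<Rightarrow> 'm" where
  "free_extension R M a u = (\<Oplus>\<^bsub>M\<^esub>x\<in>{x. u x \<noteq> \<zero>\<^bsub>R\<^esub>}. u x \<odot>\<^bsub>M\<^esub> a x)"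

lemma free_module_supp:
  assumes "u \<in> carrier (free_module R Y)"
  shows "finite {x. u x \<noteq> \<zero>\<^bsub>R\<^esub>}" "{x. u x \<noteq> \<zero>\<^bsub>R\<^esub>} \<subseteq> Y" "u x \<in> carrier R"
  using assms by (auto simp: free_module_def)

lemma free_extension_superset:
  assumes M: "module R M" and a: "a \<in> Y \<rightarrow> carrier M"
    and u: "u \<in> carrier (free_module R Y)"
    and S: "finite S" "S \<subseteq> Y" "{x. u x \<noteq> \<zero>\<^bsub>R\<^esub>} \<subseteq> S"
  shows "free_extension R M a u = (\<Oplus>\<^bsub>M\<^esub>x\<in>S. u x \<odot>\<^bsub>M\<^esub> a x)"
proof -
  interpret M: module R M by fact
  note supp = free_module_supp[OF u]
  show ?thesis unfolding free_extension_def
    by (rule M.add.finprod_mono_neutral_cong_left) (use S a supp in \<open>auto simp: Pi_def subset_iff\<close>)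
qed

lemma free_extension_hom:
  assumes M: "module R M" and a: "a \<in> Y \<rightarrow> carrier M"
  shows "free_extension R M a \<in> mod_hom R (free_module R Y) M"
proof (rule mod_homI)
  interpret M: module R M by fact
  interpret F: module R "free_module R Y" by (rule module_free_module) (rule M.R.cring_axioms)
  fix u assume u: "u \<in> carrier (free_module R Y)"
  note su = free_module_supp[OF u]
  show "free_extension R M a u \<in> carrier M"
    unfolding free_extension_def
    by (rule M.finsum_closed) (use su a in \<open>auto simp: Pi_def subset_iff\<close>)
  show "free_extension R M a (r \<odot>\<^bsub>free_module R Y\<^esub> u) = r \<odot>\<^bsub>M\<^esub> free_extension R M a u"
    if r: "r \<in> carrier R" for r
  proof -
    have "free_extension R M a (r \<odot>\<^bsub>free_module R Y\<^esub> u)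
        = (\<Oplus>\<^bsub>M\<^esub>x\<in>{x. u x \<noteq> \<zero>\<^bsub>R\<^esub>}. (r \<odot>\<^bsub>free_module R Y\<^esub> u) x \<odot>\<^bsub>M\<^esub> a x)"
      by (rule free_extension_superset[OF M a F.smult_closed[OF r u] su(1,2)])
        (use r in \<open>auto simp: free_module_def\<close>)
    also have "\<dots> = (\<Oplus>\<^bsub>M\<^esub>x\<in>{x. u x \<noteq> \<zero>\<^bsub>R\<^esub>}. r \<odot>\<^bsub>M\<^esub> (u x \<odot>\<^bsub>M\<^esub> a x))"
      by (rule M.finsum_cong')
        (use r a su in \<open>auto simp: free_module_def M.smult_assoc1 Pi_def subset_iff\<close>)
    also have "\<dots> = r \<odot>\<^bsub>M\<^esub> free_extension R M a u"
      unfolding free_extension_def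
      by (rule M.finsum_smult_ldistr[symmetric])
        (use r a su in \<open>auto simp: Pi_def subset_iff\<close>)
    finally show ?thesis .
  qed
  fix v assume v: "v \<in> carrier (free_module R Y)"
  note sv = free_module_supp[OF v]
  let ?S = "{x. u x \<noteq> \<zero>\<^bsub>R\<^esub>} \<union> {x. v x \<noteq> \<zero>\<^bsub>R\<^esub>}"
  have S: "finite ?S" "?S \<subseteq> Y" using su sv by auto
  have "free_extension R M a (u \<oplus>\<^bsub>free_module R Y\<^esub> v)
      = (\<Oplus>\<^bsub>M\<^esub>x\<in>?S. (u \<oplus>\<^bsub>free_module R Y\<^esub> v) x \<odot>\<^bsub>M\<^esub> a x)"
    by (rule free_extension_superset[OF M a F.a_closed[OF u v] S])
      (auto simp: free_module_def)
  also have "\<dots> = (\<Oplus>\<^bsub>M\<^esub>x\<in>?S. u x \<odot>\<^bsub>M\<^esub> a x \<oplus>\<^bsub>M\<^esub> v x \<odot>\<^bsub>M\<^esub> a x)"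
    by (rule M.finsum_cong')
      (use a S su(3) sv(3) in \<open>auto simp: free_module_def M.smult_l_distr Pi_def subset_iff\<close>)
  also have "\<dots> = (\<Oplus>\<^bsub>M\<^esub>x\<in>?S. u x \<odot>\<^bsub>M\<^esub> a x) \<oplus>\<^bsub>M\<^esub> (\<Oplus>\<^bsub>M\<^esub>x\<in>?S. v x \<odot>\<^bsub>M\<^esub> a x)"
    by (rule M.finsum_addf) (use a S su(3) sv(3) in \<open>auto simp: Pi_def subset_iff\<close>)
  also have "(\<Oplus>\<^bsub>M\<^esub>x\<in>?S. u x \<odot>\<^bsub>M\<^esub> a x) = free_extension R M a u"
    by (rule free_extension_superset[OF M a u S, symmetric]) auto
  also have "(\<Oplus>\<^bsub>M\<^esub>x\<in>?S. v x \<odot>\<^bsub>M\<^esub> a x) = free_extension R M a v"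
    by (rule free_extension_superset[OF M a v S, symmetric]) auto
  finally show "free_extension R M a (u \<oplus>\<^bsub>free_module R Y\<^esub> v)
      = free_extension R M a u \<oplus>\<^bsub>M\<^esub> free_extension R M a v" .
qed

lemma free_extension_single:
  assumes M: "module R M" and a: "a \<in> Y \<rightarrow> carrier M" and x: "x \<in> Y"
  defines "d \<equiv> (\<lambda>y. if y = x then \<one>\<^bsub>R\<^esub> else \<zero>\<^bsub>R\<^esub>)"
  shows "d \<in> carrier (free_module R Y)" "free_extension R M a d = a x"
proof -
  interpret M: module R M by fact
  have "{y. d y \<noteq> \<zero>\<^bsub>R\<^esub>} \<subseteq> {x}" by (auto simp: d_def)
  then show d: "d \<in> carrier (free_module R Y)"
    using x by (auto simp: free_module_def d_def intro: finite_subset)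
  have "free_extension R M a d = (\<Oplus>\<^bsub>M\<^esub>y\<in>{x}. d y \<odot>\<^bsub>M\<^esub> a y)"
    by (rule free_extension_superset[OF M a d]) (use x in \<open>auto simp: d_def\<close>)
  also have "\<dots> = a x" using a x by (auto simp: d_def Pi_def)
  finally show "free_extension R M a d = a x" .
qed

lemma projective_module_lift:
  fixes R :: "('r, 's) ring_scheme" and P :: "('r, 'p) module"
    and A :: "('r, 'a) module" and B :: "('r, 'b) module"
  assumes P: "projective_module R P" and A: "module R A" and B: "module R B"
    and p: "p \<in> mod_epi R A B" and f: "f \<in> mod_hom R P B"
  shows "\<exists>h \<in> mod_hom R P A. \<forall>x \<in> carrier P. p (h x) = f x"
proof -
  have mP: "module R P" using P by (simp add: projective_module_def)
  interpret P: module R P by fact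
  interpret A: module R A by fact
  let ?F = "free_module R (carrier P)"
  have F: "module R ?F" by (rule module_free_module) (rule P.R.cring_axioms)
  let ?e = "free_extension R P (\<lambda>x. x)"
  have e: "?e \<in> mod_hom R ?F P" by (rule free_extension_hom[OF mP]) simp
  have "carrier P \<subseteq> ?e ` carrier ?F"
  proof
    fix x assume x: "x \<in> carrier P"
    have "(\<lambda>x. x) \<in> carrier P \<rightarrow> carrier P" by simp
    from free_extension_single[OF mP this x] show "x \<in> ?e ` carrier ?F"
      by (metis imageI)
  qed
  then have epi: "?e \<in> mod_epi R ?F P" using e mod_homD(1)[OF e] by (auto simp: mod_epi_def)
  have id: "(\<lambda>x. x) \<in> mod_hom R P P" by (rule mod_homI) auto
  have "\<exists>s \<in> mod_hom R P ?F. \<forall>x \<in> carrier P. ?e (s x) = x"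
    using conjunct2[OF P[unfolded projective_module_def], THEN spec, THEN spec, THEN bspec, OF epi,
        THEN bspec, OF id] F mP by simp
  then obtain s where s: "s \<in> mod_hom R P ?F" "\<forall>x \<in> carrier P. ?e (s x) = x"
    by (elim bexE)
  have ph: "p \<in> mod_hom R A B" "p ` carrier A = carrier B" using p by (auto simp: mod_epi_def)
  have "\<forall>x \<in> carrier P. \<exists>y \<in> carrier A. p y = f x"
    using mod_homD(1)[OF f] ph(2) by (metis imageE)
  then obtain a where a: "\<And>x. x \<in> carrier P \<Longrightarrow> a x \<in> carrier A" "\<And>x. x \<in> carrier P \<Longrightarrow> p (a x) = f x"
    by metis
  let ?h = "free_extension R A a"
  have h: "?h \<in> mod_hom R ?F A" by (rule free_extension_hom[OF A]) (use a in auto)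
  interpret B: module R B by fact
  have ph_eq: "p (?h u) = f (?e u)" if u: "u \<in> carrier ?F" for u
  proof -
    note su = free_module_supp[OF u]
    let ?S = "{x. u x \<noteq> \<zero>\<^bsub>R\<^esub>}"
    have "p (?h u) = (\<Oplus>\<^bsub>B\<^esub>x\<in>?S. p (u x \<odot>\<^bsub>A\<^esub> a x))"
      unfolding free_extension_def
      by (rule mod_hom_finsum[OF A B ph(1)]) (use su a in auto)
    also have "\<dots> = (\<Oplus>\<^bsub>B\<^esub>x\<in>?S. f (u x \<odot>\<^bsub>P\<^esub> x))"
      by (rule B.finsum_cong')
        (use su a mod_homD[OF ph(1)] mod_homD[OF f] in \<open>auto simp: Pi_def subset_iff\<close>)
    also have "\<dots> = f (?e u)"
      unfolding free_extension_def
      by (rule mod_hom_finsum[OF mP B f, symmetric]) (use su in auto)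
    finally show ?thesis .
  qed
  show ?thesis
  proof (rule bexI[of _ "\<lambda>x. ?h (s x)"])
    show "(\<lambda>x. ?h (s x)) \<in> mod_hom R P A"
      by (rule mod_homI) (simp_all add: mod_homD[OF s(1)] mod_homD[OF h])
    show "\<forall>x \<in> carrier P. p (?h (s x)) = f x"
      using ph_eq s(2) mod_homD(1)[OF s(1)] by simp
  qed
qed

end

theory Submission
  imports Defs
begin

text \<open>
  Automorphism-coinvariance says that \<open>K = ker \<pi>\<close> is stable under the automorphisms of \<open>P\<close>; what has
  to be shown is that \<open>K\<close> is stable under all endomorphisms. By a dual basis of \<open>P\<close> it suffices to
  treat the rank-one maps \<open>v \<otimes> \<phi> : x \<mapsto> \<phi>(x) v\<close>. If \<open>1 + \<phi>(v)\<close> is a unit, then \<open>1 + v \<otimes> \<phi>\<close> is an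
  automorphism, so \<open>v \<otimes> \<phi>\<close> preserves \<open>K\<close>.

  In general, the \<open>r \<in> R\<close> with \<open>r \<phi>(x) v \<in> K\<close> form an ideal, and for each maximal ideal \<open>m\<close> it has to
  contain an element outside \<open>m\<close>: an idempotent \<open>e \<notin> m\<close> with \<open>e m\<close> inside the Jacobson radical \<open>J\<close>,
  so that \<open>eR\<close> is local. If \<open>\<phi>(v) \<in> m\<close>, then \<open>1 + e \<phi>(v)\<close> is a unit. Otherwise \<open>eP\<close> is \<open>eRv\<close> plus the
  summand \<open>Q = eP \<inter> ker \<phi>\<close>. Either some functional is outside \<open>m\<close> on some \<open>q \<in> Q\<close>, and then
  \<open>e (v \<otimes> \<phi>)\<close> factors as a product of two square-zero rank-one maps through \<open>q\<close>; or \<open>Q = J Q\<close>, hence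
  \<open>Q = 0\<close> by T-nilpotence, and \<open>e (v \<otimes> \<phi>)\<close> is multiplication by \<open>e \<phi>(v)\<close> because \<open>R\<close> is commutative.
\<close>

section \<open>Maximal ideals and idempotents of commutative perfect rings\<close>

text \<open>Krull's theorem, by Zorn on the ideals above \<open>I\<close> that avoid
  \<open>\<one>\<close>: this class is closed under unions of nonempty chains.\<close>

lemma (in cring) exists_maximalideal:
  assumes I: "ideal I R" and "I \<noteq> carrier R"
  obtains m where "maximalideal m R" "I \<subseteq> m"
proof -
  let ?A = "{J. ideal J R \<and> I \<subseteq> J \<and> \<one> \<notin> J}"
  have IA: "I \<in> ?A" using assms ideal.one_imp_carrier by blast
  have "\<exists>M\<in>?A. \<forall>Y\<in>?A. M \<subseteq> Y \<longrightarrow> Y = M"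
  proof (rule subset_Zorn_nonempty)
    show "?A \<noteq> {}" using IA by blast
    fix C assume C: "C \<noteq> {}" "subset.chain ?A C"
    then have "subset.chain {I. ideal I R} C" by (auto simp: subset_chain_def)
    from chain_Union_is_ideal[OF this] C show "\<Union>C \<in> ?A"
      by (auto simp: subset_chain_def)
  qed
  then obtain m where m: "ideal m R" "I \<subseteq> m" "\<one> \<notin> m"
    and max: "\<And>Y. ideal Y R \<Longrightarrow> I \<subseteq> Y \<Longrightarrow> \<one> \<notin> Y \<Longrightarrow> m \<subseteq> Y \<Longrightarrow> Y = m" by auto
  have "maximalideal m R"
  proof (rule maximalidealI[OF m(1)])
    show "carrier R \<noteq> m" using m(3) by auto
    fix J assume J: "ideal J R" "m \<subseteq> J" "J \<subseteq> carrier R"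
    show "J = m \<or> J = carrier R"
      using max[OF J(1)] J m(2) ideal.one_imp_carrier[OF J(1)] by blast
  qed
  with m(2) that show thesis by blast
qed

text \<open>Otherwise \<open>\<one> \<oplus> j\<close> generates a proper ideal inside some maximal
  ideal; that one also contains \<open>j\<close>, hence \<open>\<one>\<close>.\<close>

lemma (in cring) one_plus_jacobson_radical_Units:
  assumes j: "j \<in> jacobson_radical R"
  shows "\<one> \<oplus> j \<in> Units R"
proof (rule ccontr)
  have jc: "j \<in> carrier R" using j by (simp add: jacobson_radical_def)
  let ?u = "\<one> \<oplus> j"
  have uc: "?u \<in> carrier R" using jc by simp
  assume "?u \<notin> Units R"
  then have "\<one> \<notin> PIdl ?u"
    using uc by (force simp: cgenideal_def Units_def m_comm)
  then have "PIdl ?u \<noteq> carrier R" by auto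
  then obtain m where m: "maximalideal m R" "PIdl ?u \<subseteq> m"
    using exists_maximalideal[OF cgenideal_ideal[OF uc]] by blast
  interpret m: maximalideal m R by fact
  have "?u \<in> m" using m(2) cgenideal_self[OF uc] by blast
  moreover have "j \<in> m" using j m(1) by (simp add: jacobson_radical_def)
  ultimately have "?u \<ominus> j \<in> m" by (simp add: a_minus_def)
  moreover have "?u \<ominus> j = \<one>" using jc by algebra
  ultimately show False using m.one_imp_carrier m.I_notcarr by simp
qed

text \<open>The cofactor \<open>t\<close> is the geometric sum of the powers of \<open>y\<close>
  below \<open>n\<close>; later only its existence matters.\<close>

lemma (in cring) one_minus_pow_factor:
  assumes y: "y \<in> carrier R"
  shows "\<exists>t \<in> carrier R. \<one> \<ominus> y [^] (n::nat) = (\<one> \<ominus> y) \<otimes> t"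
proof (induct n)
  case 0
  show ?case using y by (intro bexI[of _ \<zero>]) (simp_all add: a_minus_def r_neg)
next
  case (Suc n)
  then obtain t where t: "t \<in> carrier R" "\<one> \<ominus> y [^] n = (\<one> \<ominus> y) \<otimes> t" by blast
  have *: "\<one> \<ominus> w \<otimes> y = (\<one> \<ominus> y) \<oplus> (\<one> \<ominus> w) \<otimes> y" if "w \<in> carrier R" for w
    using that y by algebra
  have "\<one> \<ominus> y [^] Suc n = (\<one> \<ominus> y) \<oplus> (\<one> \<ominus> y) \<otimes> t \<otimes> y"
    using *[of "y [^] n"] y t by simp
  also have "\<dots> = (\<one> \<ominus> y) \<otimes> (\<one> \<oplus> t \<otimes> y)"
    using y t by algebra
  finally show ?case using y t by blast
qed

lemma (in cring) ideal_jacobson_radical: "ideal (jacobson_radical R) R"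
proof (cases "\<exists>m. maximalideal m R")
  case True
  have "x \<in> carrier R" if "maximalideal m R" "x \<in> m" for m x
    using that by (auto dest: maximalideal.axioms(1) ideal.Icarr)
  with True have "jacobson_radical R = \<Inter>{I. maximalideal I R}"
    unfolding jacobson_radical_def by blast
  with True show ?thesis
    by (auto intro!: i_Intersect simp: maximalideal.axioms(1))
next
  \<comment> \<open>Without maximal ideals (the zero ring) the defining condition is vacuous and
    there is no nonempty family to intersect.\<close>
  case False
  then have "jacobson_radical R = carrier R" by (simp add: jacobson_radical_def)
  then show ?thesis by (simp add: oneideal)
qed

text \<open>T-nilpotence is applied to the constant sequence; the product over \<open>{..n}\<close>
  has \<open>n + 1\<close> factors, whence \<open>Suc n\<close>.\<close>

lemma T_nilpotent_imp_nilpotent: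
  assumes "cring R" "T_nilpotent R J" "J \<subseteq> carrier R" "c \<in> J"
  shows "\<exists>n. c [^]\<^bsub>R\<^esub> Suc n = \<zero>\<^bsub>R\<^esub>"
proof -
  interpret cring R by fact
  obtain n where "(\<Otimes>\<^bsub>R\<^esub>i\<in>{..n::nat}. c) = \<zero>\<^bsub>R\<^esub>"
    using assms(2,4) unfolding T_nilpotent_def by (elim allE[of _ "\<lambda>_. c"]) auto
  moreover have "(\<Otimes>\<^bsub>R\<^esub>i\<in>{..n::nat}. c) = c [^]\<^bsub>R\<^esub> Suc n"
    using finprod_const[of c "{..n}"] assms(3,4) by auto
  ultimately show ?thesis by metis
qed

text \<open>\<open>I\<close> is the preimage of a complement of the image of \<open>m\<close> in the
  semisimple quotient. Trivial intersection there becomes \<open>m \<inter> I \<subseteq> J\<close>,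
  and splitting the class of \<open>\<one>\<close> gives \<open>a\<close>.\<close>

lemma (in cring) semisimple_Quot_complement:
  assumes ss: "semisimple_cring (R Quot J)" and J: "ideal J R" and m: "ideal m R"
  shows "\<exists>I a. ideal I R \<and> m \<inter> I \<subseteq> J \<and> a \<in> m \<and> \<one> \<ominus> a \<in> I"
proof -
  let ?Q = "R Quot J" and ?h = "(+>) J"
  have h: "?h \<in> ring_hom R ?Q" by (rule ideal.rcos_ring_hom[OF J])
  have hr: "ring_hom_ring R ?Q ?h" by (rule ideal.rcos_ring_hom_ring[OF J])
  have mc: "m \<subseteq> carrier R" using ideal.Icarr[OF m] by blast
  have mid: "ideal (?h ` m) ?Q" by (rule ring_ideal_imp_quot_ideal[OF J m])
  obtain I where I: "ideal I ?Q" "?h ` m <+>\<^bsub>?Q\<^esub> I = carrier ?Q" "?h ` m \<inter> I = {\<zero>\<^bsub>?Q\<^esub>}"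
    using ss[unfolded semisimple_cring_def, THEN conjunct2, rule_format, OF mid] by blast
  let ?I = "{r \<in> carrier R. J +> r \<in> I}"
  have Iid: "ideal ?I R" by (rule ring_hom_ring.ideal_vimage[OF hr I(1)])
  have zq: "\<zero>\<^bsub>?Q\<^esub> = J" by (simp add: FactRing_def)
  have inter: "m \<inter> ?I \<subseteq> J"
  proof
    fix r assume r: "r \<in> m \<inter> ?I"
    then have "J +> r \<in> ?h ` m \<inter> I" by blast
    then have "J +> r = J" unfolding I(3) zq by blast
    with r show "r \<in> J" using ideal.rcos_const_imp_mem[OF J, of r] by blast
  qed
  have "J +> \<one> \<in> ?h ` m <+>\<^bsub>?Q\<^esub> I" unfolding I(2) using ring_hom_closed[OF h] by simp
  then obtain a y where a: "a \<in> m" and y: "y \<in> I" and ay: "J +> \<one> = (J +> a) \<oplus>\<^bsub>?Q\<^esub> y"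
    unfolding set_add_def' by blast
  have ac: "a \<in> carrier R" using a mc by blast
  have yc: "y \<in> carrier ?Q" using y ideal.Icarr[OF I(1)] by blast
  interpret Q: ring ?Q by (rule ideal.quotient_is_ring[OF J])
  \<comment> \<open>So far \<open>y\<close> is only some coset in \<open>I\<close>; cancelling the
    class of \<open>a\<close> identifies it as the class of
    \<open>\<one> \<ominus> a\<close>.\<close>
  have "(J +> a) \<oplus>\<^bsub>?Q\<^esub> (J +> (\<one> \<ominus> a)) = J +> (a \<oplus> (\<one> \<ominus> a))"
    using ring_hom_add[OF h, of a "\<one> \<ominus> a"] ac by simp
  also have "a \<oplus> (\<one> \<ominus> a) = \<one>" using ac by algebra
  finally have "(J +> a) \<oplus>\<^bsub>?Q\<^esub> (J +> (\<one> \<ominus> a)) = (J +> a) \<oplus>\<^bsub>?Q\<^esub> y" unfolding ay .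
  then have "J +> (\<one> \<ominus> a) = y"
    using ring_hom_closed[OF h, of a] ring_hom_closed[OF h, of "\<one> \<ominus> a"] ac yc
      Q.add.l_cancel[of "J +> a" "J +> (\<one> \<ominus> a)" y] by simp
  then have "\<one> \<ominus> a \<in> ?I" using ac y by simp
  with inter Iid a show ?thesis by blast
qed

text \<open>Modulo the radical, \<open>m\<close> has a complement; the component of
  \<open>\<one>\<close> in it is lifted to an idempotent \<open>e\<close> in the preimage
  \<open>I'\<close>. Then \<open>e m\<close> lies in \<open>m \<inter> I'\<close>, hence in the
  radical, and \<open>e\<close> avoids \<open>m\<close> because \<open>\<one> \<ominus> e\<close> is
  a multiple of \<open>a\<close>.\<close>

lemma (in cring) perfect_cring_local_idempotent:
  assumes perf: "perfect_cring R" and m: "maximalideal m R"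
  shows "\<exists>e \<in> carrier R. e \<otimes> e = e \<and> e \<notin> m \<and> (\<forall>r \<in> m. e \<otimes> r \<in> jacobson_radical R)"
proof -
  interpret m: maximalideal m R by fact
  let ?J = "jacobson_radical R"
  have J: "ideal ?J R" by (rule ideal_jacobson_radical)
  have ss: "semisimple_cring (R Quot ?J)" and T: "T_nilpotent R ?J"
    using perf by (simp_all add: perfect_cring_def)
  obtain I' a where I': "ideal I' R" and mI': "m \<inter> I' \<subseteq> ?J" and a: "a \<in> m" and "\<one> \<ominus> a \<in> I'"
    using semisimple_Quot_complement[OF ss J m.ideal_axioms] by blast
  define b where "b = \<one> \<ominus> a"
  have bI: "b \<in> I'" using \<open>\<one> \<ominus> a \<in> I'\<close> by (simp add: b_def)
  interpret I': ideal I' R by (rule I')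
  have inter: "r \<in> ?J" if "r \<in> m" "r \<in> I'" for r using mI' that by blast
  have ac: "a \<in> carrier R" using a by (rule m.Icarr)
  have bc: "b \<in> carrier R" using ac by (simp add: b_def)
  have ab: "\<one> \<ominus> b = a" using ac unfolding b_def by algebra
  have "a \<otimes> b \<in> ?J" by (rule inter[OF m.I_r_closed[OF a bc] I'.I_l_closed[OF bI ac]])
  then obtain n where n: "(a \<otimes> b) [^] Suc n = \<zero>"
    using T_nilpotent_imp_nilpotent[OF cring_axioms T] ideal.Icarr[OF J] by blast
  \<comment> \<open>\<open>b\<close> is idempotent modulo the nilpotent \<open>a \<otimes> b\<close>; since \<open>b [^] Suc n\<close> divides \<open>e\<close> and
    \<open>a [^] Suc n\<close> divides \<open>\<one> \<ominus> e\<close>, \<open>e\<close> is an idempotent lift of it.\<close>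
  define c where "c = b [^] Suc n"
  define e where "e = \<one> \<ominus> (\<one> \<ominus> c) [^] Suc n"
  have cc: "c \<in> carrier R" and ec: "e \<in> carrier R" using bc by (simp_all add: c_def e_def del: nat_pow_Suc)
  obtain t where t: "t \<in> carrier R" "\<one> \<ominus> c = a \<otimes> t"
    using one_minus_pow_factor[OF bc, of "Suc n"] unfolding ab c_def by blast
  have dd: "\<one> \<ominus> (\<one> \<ominus> x) = x" if "x \<in> carrier R" for x using that by algebra
  then obtain w where w: "w \<in> carrier R" "e = c \<otimes> w"
    using one_minus_pow_factor[of "\<one> \<ominus> c" "Suc n"] cc dd[OF cc] unfolding e_def by (auto simp del: nat_pow_Suc)
  have e1: "\<one> \<ominus> e = a [^] Suc n \<otimes> t [^] Suc n"
  proof -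
    have "\<one> \<ominus> e = (\<one> \<ominus> c) [^] Suc n"
      using dd[of "(\<one> \<ominus> c) [^] Suc n"] cc unfolding e_def by (simp del: nat_pow_Suc)
    also have "\<dots> = a [^] Suc n \<otimes> t [^] Suc n"
      unfolding t(2) using ac t(1) by (rule nat_pow_distrib)
    finally show ?thesis .
  qed
  have "e \<otimes> (\<one> \<ominus> e) = (b [^] Suc n \<otimes> w) \<otimes> (a [^] Suc n \<otimes> t [^] Suc n)"
    using e1 w(2) c_def by metis
  also have "\<dots> = (a [^] Suc n \<otimes> b [^] Suc n) \<otimes> (w \<otimes> t [^] Suc n)"
    using ac bc w(1) t(1) by (simp add: m_ac del: nat_pow_Suc)
  also have "a [^] Suc n \<otimes> b [^] Suc n = \<zero>" using n nat_pow_distrib[OF ac bc] by metis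
  finally have "e \<otimes> (\<one> \<ominus> e) = \<zero>" using w t by (simp del: nat_pow_Suc)
  moreover have "e = e \<otimes> e \<oplus> e \<otimes> (\<one> \<ominus> e)" using ec by algebra
  ultimately have ee: "e \<otimes> e = e" using ec by simp
  have em: "e \<notin> m"
  proof
    assume "e \<in> m"
    moreover have "\<one> \<ominus> e \<in> m"
      unfolding e1 using m.I_l_closed[OF a, of "a [^] n"] ac t(1) by (auto intro: m.I_r_closed)
    ultimately have "e \<oplus> (\<one> \<ominus> e) \<in> m" by blast
    moreover have "e \<oplus> (\<one> \<ominus> e) = \<one>" using ec by algebra
    ultimately show False using m.one_imp_carrier m.I_notcarr by simp
  qed
  have eI: "e \<in> I'"
    unfolding w(2) c_def using I'.I_l_closed[OF bI, of "b [^] n"] bc w(1) by (auto intro: I'.I_r_closed)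
  have "e \<otimes> r \<in> ?J" if "r \<in> m" for r
    using that ec eI m.Icarr by (intro inter m.I_l_closed I'.I_r_closed) auto
  with ee em ec show ?thesis by blast
qed

text \<open>Elements outside \<open>m\<close> become invertible in \<open>eR\<close>: maximality
  gives \<open>\<one> = s \<otimes> r \<oplus> t\<close> with \<open>t\<close> in \<open>m\<close>,
  and \<open>e \<otimes> t\<close> lies in the radical, so the error can be divided out.\<close>

lemma (in cring) local_idempotent_invertible:
  assumes m: "maximalideal m R" and e: "e \<in> carrier R"
    and ee: "e \<otimes> e = e"
    and eJ: "\<And>r. r \<in> m \<Longrightarrow> e \<otimes> r \<in> jacobson_radical R"
    and r: "r \<in> carrier R" "r \<notin> m"
  shows "\<exists>s \<in> carrier R. e \<otimes> (r \<otimes> s) = e"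
proof -
  interpret m: maximalideal m R by fact
  have sum: "ideal (PIdl r <+>\<^bsub>R\<^esub> m) R" by (rule add_ideals[OF cgenideal_ideal[OF r(1)] m.ideal_axioms])
  have add: "x \<oplus> y \<in> PIdl r <+>\<^bsub>R\<^esub> m" if "x \<in> PIdl r" "y \<in> m" for x y
    using that unfolding set_add_def' by blast
  have "r \<in> PIdl r <+>\<^bsub>R\<^esub> m"
    using add[OF cgenideal_self[OF r(1)] m.zero_closed] r(1) by simp
  moreover have "m \<subseteq> PIdl r <+>\<^bsub>R\<^esub> m"
  proof
    fix x assume x: "x \<in> m"
    have "\<zero> \<in> PIdl r"
      using cgenideal_ideal[OF r(1)] by (rule additive_subgroup.zero_closed[OF ideal.axioms(1)])
    from add[OF this x] show "x \<in> PIdl r <+>\<^bsub>R\<^esub> m" using m.Icarr[OF x] by simp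
  qed
  ultimately have "PIdl r <+>\<^bsub>R\<^esub> m = carrier R"
    using m.I_maximal[OF sum] r(2) ideal.Icarr[OF sum] by blast
  then have "\<one> \<in> PIdl r <+>\<^bsub>R\<^esub> m" by simp
  then obtain s t where s: "s \<in> carrier R" and t: "t \<in> m" and st: "\<one> = s \<otimes> r \<oplus> t"
    by (auto simp: set_add_def' cgenideal_def)
  have tc: "t \<in> carrier R" using t by (rule m.Icarr)
  have "e \<otimes> (\<ominus> t) \<in> jacobson_radical R" using eJ t by simp
  then have u: "\<one> \<oplus> e \<otimes> (\<ominus> t) \<in> Units R" by (rule one_plus_jacobson_radical_Units)
  let ?u = "\<one> \<oplus> e \<otimes> (\<ominus> t)"
  have uc: "?u \<in> carrier R" "inv ?u \<in> carrier R" using u by auto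
  have "e \<otimes> (r \<otimes> s) = e \<otimes> (s \<otimes> r \<oplus> t) \<oplus> e \<otimes> (\<ominus> t)"
    using e r s tc by algebra
  \<comment> \<open>Idempotence supplies a second \<open>e\<close>, so that \<open>e\<close> splits
    off from the unit \<open>?u\<close>.\<close>
  also have "\<dots> = e \<oplus> (e \<otimes> e) \<otimes> (\<ominus> t)" using e st[symmetric] ee by simp
  also have "\<dots> = e \<otimes> ?u" using e tc by algebra
  finally have "e \<otimes> (r \<otimes> s) \<otimes> inv ?u = e \<otimes> (?u \<otimes> inv ?u)"
    using e uc by (simp add: m_assoc)
  then have "e \<otimes> (r \<otimes> (s \<otimes> inv ?u)) = e"
    using e r s uc u by (simp add: m_assoc)
  then show ?thesis using s uc by blast
qed

section \<open>Functionals and rank-one endomorphisms\<close>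

text \<open>These are the elements of the dual module Hom(P, R). Spelling them out avoids packing
  \<open>R\<close> as a module record over itself, which \<open>mod_hom\<close> would
  require.\<close>

definition functional :: "('r, 's) ring_scheme \<Rightarrow> ('r, 'p) module \<Rightarrow> ('p \<Rightarrow> 'r) \<Rightarrow> bool" where
  "functional R P \<phi> \<longleftrightarrow> \<phi> \<in> carrier P \<rightarrow> carrier R \<and>
     (\<forall>x \<in> carrier P. \<forall>y \<in> carrier P. \<phi> (x \<oplus>\<^bsub>P\<^esub> y) = \<phi> x \<oplus>\<^bsub>R\<^esub> \<phi> y) \<and>
     (\<forall>a \<in> carrier R. \<forall>x \<in> carrier P. \<phi> (a \<odot>\<^bsub>P\<^esub> x) = a \<otimes>\<^bsub>R\<^esub> \<phi> x)"

lemma functionalD: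
  assumes "functional R P \<phi>"
  shows "\<And>x. x \<in> carrier P \<Longrightarrow> \<phi> x \<in> carrier R"
    and "\<And>x y. x \<in> carrier P \<Longrightarrow> y \<in> carrier P \<Longrightarrow> \<phi> (x \<oplus>\<^bsub>P\<^esub> y) = \<phi> x \<oplus>\<^bsub>R\<^esub> \<phi> y"
    and "\<And>a x. a \<in> carrier R \<Longrightarrow> x \<in> carrier P \<Longrightarrow> \<phi> (a \<odot>\<^bsub>P\<^esub> x) = a \<otimes>\<^bsub>R\<^esub> \<phi> x"
  using assms by (auto simp: functional_def)

text \<open>The canonical map from the free module on all elements of \<open>P\<close> onto
  \<open>P\<close> splits. The coordinates of a section are the functionals, so the generators are
  the elements \<open>y\<close> of \<open>P\<close> themselves.\<close>

lemma projective_module_dual_basis: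
  fixes P :: "('r, 'p) module"
  assumes P: "projective_module R P"
  obtains \<Phi> where "\<And>y. functional R P (\<Phi> y)"
    and "\<And>x. x \<in> carrier P \<Longrightarrow> finite {y. \<Phi> y x \<noteq> \<zero>\<^bsub>R\<^esub>}"
    and "\<And>x. x \<in> carrier P \<Longrightarrow> {y. \<Phi> y x \<noteq> \<zero>\<^bsub>R\<^esub>} \<subseteq> carrier P"
    and "\<And>x. x \<in> carrier P \<Longrightarrow> (\<Oplus>\<^bsub>P\<^esub>y\<in>{y. \<Phi> y x \<noteq> \<zero>\<^bsub>R\<^esub>}. \<Phi> y x \<odot>\<^bsub>P\<^esub> y) = x"
proof -
  have mP: "module R P" using P by (simp add: projective_module_def)
  interpret P: module R P by fact
  let ?F = "free_module R (carrier P)" and ?e = "free_extension R P (\<lambda>x. x)"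
  have F: "module R ?F" by (rule module_free_module) (rule P.R.cring_axioms)
  have e: "?e \<in> mod_hom R ?F P" by (rule free_extension_hom[OF mP]) simp
  have id: "(\<lambda>x. x) \<in> carrier P \<rightarrow> carrier P" by simp
  have "x \<in> ?e ` carrier ?F" if "x \<in> carrier P" for x
    by (rule image_eqI[where f = ?e])
      (rule free_extension_single(2)[OF mP id that, symmetric], rule free_extension_single(1)[OF mP id that])
  then have epi: "?e \<in> mod_epi R ?F P" using e mod_homD(1)[OF e] by (auto simp: mod_epi_def)
  have "(\<lambda>x. x) \<in> mod_hom R P P" by (rule mod_homI) auto
  from projective_module_lift[OF P F mP epi this] obtain s
    where s: "s \<in> mod_hom R P ?F" and es: "\<And>x. x \<in> carrier P \<Longrightarrow> ?e (s x) = x" by auto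
  note sD = mod_homD[OF s]
  show thesis
  proof (rule that[of "\<lambda>y x. s x y"])
    show "functional R P (\<lambda>x. s x y)" for y
      using free_module_supp(3)[OF sD(1)] sD(2,3)
      by (auto simp: functional_def free_module_def)
    fix x assume x: "x \<in> carrier P"
    show "finite {y. s x y \<noteq> \<zero>\<^bsub>R\<^esub>}" "{y. s x y \<noteq> \<zero>\<^bsub>R\<^esub>} \<subseteq> carrier P"
      using free_module_supp(1,2)[OF sD(1)[OF x]] by auto
    show "(\<Oplus>\<^bsub>P\<^esub>y\<in>{y. s x y \<noteq> \<zero>\<^bsub>R\<^esub>}. s x y \<odot>\<^bsub>P\<^esub> y) = x"
      using es[OF x] by (simp add: free_extension_def)
  qed
qed

section \<open>Finite sums in submodules and a Nakayama lemma from T-nilpotence\<close>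

lemma (in module) finsum_mem_submodule:
  assumes K: "submodule K R M" and S: "finite S" and u: "\<And>i. i \<in> S \<Longrightarrow> u i \<in> K"
  shows "(\<Oplus>\<^bsub>M\<^esub>i\<in>S. u i) \<in> K"
proof -
  note E = submoduleE[OF K]
  have "\<zero>\<^bsub>M\<^esub> \<in> K" using E(2) E(4)[of \<zero>] E(1) smult_l_null by (metis R.zero_closed ex_in_conv subsetD)
  with S u show ?thesis
    by (induct S) (use E(1,5) in \<open>auto simp: Pi_def subset_iff\<close>)
qed

text \<open>Expanding a nonzero element again and again, some summand always survives multiplication
  by the coefficients collected so far. This yields a sequence in \<open>J\<close> with no vanishing
  initial product. No finite generation is involved.\<close>

lemma (in module) T_nilpotent_Nakayama:
  assumes T: "T_nilpotent R J" and J: "J \<subseteq> carrier R" and Q: "Q \<subseteq> carrier M"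
    and gen: "\<And>q. q \<in> Q \<Longrightarrow>
      \<exists>S c u. finite S \<and> c \<in> S \<rightarrow> J \<and> u \<in> S \<rightarrow> Q \<and> q = (\<Oplus>\<^bsub>M\<^esub>i\<in>(S :: 'i set). c i \<odot>\<^bsub>M\<^esub> u i)"
    and q: "q \<in> Q"
  shows "q = \<zero>\<^bsub>M\<^esub>"
proof (rule ccontr)
  assume q0: "q \<noteq> \<zero>\<^bsub>M\<^esub>"
  \<comment> \<open>A state of the expansion: \<open>c\<close> is the product of the coefficients
    chosen so far, \<open>q\<close> the element to be expanded next.\<close>
  let ?S = "\<lambda>(c, q). c \<in> carrier R \<and> q \<in> Q \<and> c \<odot>\<^bsub>M\<^esub> q \<noteq> \<zero>\<^bsub>M\<^esub>"
  have step: "\<exists>a q'. a \<in> J \<and> ?S (c \<otimes> a, q')" if "?S (c, q)" for c q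
  proof (rule ccontr)
    assume no: "\<nexists>a q'. a \<in> J \<and> ?S (c \<otimes> a, q')"
    have c: "c \<in> carrier R" "q \<in> Q" "c \<odot>\<^bsub>M\<^esub> q \<noteq> \<zero>\<^bsub>M\<^esub>" using that by auto
    obtain S :: "'i set" and d u where S: "finite S" "d \<in> S \<rightarrow> J" "u \<in> S \<rightarrow> Q"
      and qs: "q = (\<Oplus>\<^bsub>M\<^esub>i\<in>S. d i \<odot>\<^bsub>M\<^esub> u i)" using gen[OF c(2)] by blast
    have du: "d i \<in> carrier R" "u i \<in> carrier M" "d i \<in> J" "u i \<in> Q" if "i \<in> S" for i
      using S J Q that by auto
    have "c \<odot>\<^bsub>M\<^esub> q = (\<Oplus>\<^bsub>M\<^esub>i\<in>S. c \<odot>\<^bsub>M\<^esub> (d i \<odot>\<^bsub>M\<^esub> u i))"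
      unfolding qs by (rule finsum_smult_ldistr[OF S(1) c(1)]) (use du in auto)
    also have "\<dots> = \<zero>\<^bsub>M\<^esub>"
    proof (rule M.add.finprod_one_eqI)
      fix i assume i: "i \<in> S"
      then show "c \<odot>\<^bsub>M\<^esub> (d i \<odot>\<^bsub>M\<^esub> u i) = \<zero>\<^bsub>M\<^esub>"
        using no du[OF i] c(1) smult_assoc1[of c "d i" "u i"] by auto
    qed
    finally show False using c(3) by simp
  qed
  have "\<exists>f. \<forall>n. (?S (f n) \<and> (n = 0 \<longrightarrow> f n = (\<one>, q))) \<and> (\<exists>a\<in>J. fst (f (Suc n)) = fst (f n) \<otimes> a)"
  proof (rule dependent_nat_choice)
    show "\<exists>x. ?S x \<and> ((0::nat) = 0 \<longrightarrow> x = (\<one>, q))" using q q0 Q by auto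
    fix x :: "'a \<times> 'c" and n :: nat
    assume "?S x \<and> (n = 0 \<longrightarrow> x = (\<one>, q))"
    then obtain a q' where "a \<in> J" "?S (fst x \<otimes> a, q')"
      using step[of "fst x" "snd x"] by (auto split: prod.splits)
    then show "\<exists>y. (?S y \<and> (Suc n = 0 \<longrightarrow> y = (\<one>, q))) \<and> (\<exists>a\<in>J. fst y = fst x \<otimes> a)"
      by (intro exI[of _ "(fst x \<otimes> a, q')"]) auto
  qed
  then obtain f where f: "\<forall>n. (?S (f n) \<and> (n = 0 \<longrightarrow> f n = (\<one>, q))) \<and>
      (\<exists>a\<in>J. fst (f (Suc n)) = fst (f n) \<otimes> a)" ..
  have f1: "?S (f n)" for n by (rule f[THEN spec, THEN conjunct1, THEN conjunct1])
  have f2: "f 0 = (\<one>, q)" by (rule f[THEN spec, THEN conjunct1, THEN conjunct2, THEN mp]) (rule refl)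
  have "\<forall>n. \<exists>a. a \<in> J \<and> fst (f (Suc n)) = fst (f n) \<otimes> a"
  proof
    fix n
    show "\<exists>a. a \<in> J \<and> fst (f (Suc n)) = fst (f n) \<otimes> a"
      using f[THEN spec, of n, THEN conjunct2] by blast
  qed
  from choice[OF this] obtain a where a: "\<And>n. a n \<in> J" "\<And>n. fst (f (Suc n)) = fst (f n) \<otimes> a n"
    by blast
  have ac: "a n \<in> carrier R" for n using a(1) J by auto
  \<comment> \<open>The start \<open>f 0\<close> carries the empty product \<open>\<one>\<close>, so
    state \<open>Suc n\<close> carries \<open>a 0\<close> up to \<open>a n\<close>, the range
    \<open>{..n}\<close> of \<open>T_nilpotent\<close>.\<close>
  have prod: "fst (f (Suc n)) = (\<Otimes>i\<in>{..n}. a i)" for n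
  proof (induct n)
    case 0
    show ?case using a(2)[of 0] f2 ac by simp
  next
    case (Suc n)
    show ?case unfolding a(2)[of "Suc n"] Suc using ac by (simp add: atMost_Suc m_comm)
  qed
  obtain n where "(\<Otimes>i\<in>{..n}. a i) = \<zero>" using T a(1) unfolding T_nilpotent_def by blast
  then have "fst (f (Suc n)) = \<zero>" by (simp add: prod)
  then show False using f1[of "Suc n"] Q by (auto simp: split_beta)
qed

section \<open>Automorphisms of the form identity plus rank one\<close>

lemma functional_lincomb:
  assumes P: "module R P" and \<phi>: "functional R P \<phi>" and \<psi>: "functional R P \<psi>"
    and a: "a \<in> carrier R" "b \<in> carrier R"
  shows "functional R P (\<lambda>x. a \<otimes>\<^bsub>R\<^esub> \<phi> x \<oplus>\<^bsub>R\<^esub> b \<otimes>\<^bsub>R\<^esub> \<psi> x)"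
proof -
  interpret P: module R P by fact
  show ?thesis
    using a functionalD[OF \<phi>] functionalD[OF \<psi>] unfolding functional_def
    by (auto simp: P.R.r_distr P.R.m_ac P.R.a_ac)
qed

text \<open>The map multiplies \<open>\<phi>\<close> by the unit
  \<open>\<one> \<oplus> \<phi> v\<close>. The inverse is therefore again identity plus rank one,
  with coefficient \<open>\<ominus> (?w \<otimes> \<phi> x)\<close> (Sherman-Morrison).\<close>

lemma rank_one_mod_aut:
  fixes R (structure) and M :: "('r, 'm) module"
  assumes mod: "module R M" and \<phi>: "functional R M \<phi>" and v: "v \<in> carrier M" and u: "\<one> \<oplus> \<phi> v \<in> Units R"
  shows "(\<lambda>x. x \<oplus>\<^bsub>M\<^esub> \<phi> x \<odot>\<^bsub>M\<^esub> v) \<in> mod_aut R M"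
proof -
  interpret module R M by fact
  note D = functionalD[OF \<phi>]
  let ?g = "\<lambda>x. x \<oplus>\<^bsub>M\<^esub> \<phi> x \<odot>\<^bsub>M\<^esub> v"
  let ?w = "inv (\<one> \<oplus> \<phi> v)"
  let ?h = "\<lambda>x. x \<oplus>\<^bsub>M\<^esub> (\<ominus> (?w \<otimes> \<phi> x)) \<odot>\<^bsub>M\<^esub> v"
  have pv: "\<phi> v \<in> carrier R" using D v by simp
  have w: "?w \<in> carrier R" "(\<one> \<oplus> \<phi> v) \<otimes> ?w = \<one>" using u by auto
  have hom: "?g \<in> mod_hom R M M"
  proof (rule mod_homI)
    show "?g (x \<oplus>\<^bsub>M\<^esub> y) = ?g x \<oplus>\<^bsub>M\<^esub> ?g y" if "x \<in> carrier M" "y \<in> carrier M" for x y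
      using that D v by (simp add: smult_l_distr M.a_ac)
    show "?g (a \<odot>\<^bsub>M\<^esub> x) = a \<odot>\<^bsub>M\<^esub> ?g x" if "a \<in> carrier R" "x \<in> carrier M" for a x
      using that D v by (simp add: smult_r_distr smult_assoc1)
  qed (use D v in simp)
  have hc: "?h x \<in> carrier M" if "x \<in> carrier M" for x using that D v w(1) by simp
  have hg: "?h (?g x) = x" if x: "x \<in> carrier M" for x
  proof -
    have p: "\<phi> x \<in> carrier R" using D x by simp
    have "\<phi> (?g x) = \<phi> x \<otimes> (\<one> \<oplus> \<phi> v)" using D x v p pv by (simp add: R.r_distr)
    then have "?w \<otimes> \<phi> (?g x) = \<phi> x \<otimes> ((\<one> \<oplus> \<phi> v) \<otimes> ?w)" using p pv w(1) by (simp add: R.m_ac)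
    also have "\<dots> = \<phi> x" using w p by simp
    finally have e: "?w \<otimes> \<phi> (?g x) = \<phi> x" .
    show "?h (?g x) = x" unfolding e
      using p v x by (simp add: M.a_assoc smult_l_distr[symmetric] R.r_neg)
  qed
  have gh: "?g (?h x) = x" if x: "x \<in> carrier M" for x
  proof -
    have p: "\<phi> x \<in> carrier R" using D x by simp
    let ?k = "\<ominus> (?w \<otimes> \<phi> x)"
    have k: "?k \<in> carrier R" using p w by simp
    have "\<phi> (?h x) = ((\<one> \<oplus> \<phi> v) \<otimes> ?w) \<otimes> \<phi> x \<oplus> ?k \<otimes> \<phi> v"
      using D x v p pv w k by simp
    also have "\<dots> = ?w \<otimes> \<phi> x" using p pv w(1) by algebra
    finally have e: "\<phi> (?h x) = ?w \<otimes> \<phi> x" .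
    show "?g (?h x) = x" unfolding e
      using p v x w k by (simp add: M.a_assoc smult_l_distr[symmetric] R.l_neg)
  qed
  have "bij_betw ?g (carrier M) (carrier M)"
    by (rule bij_betw_byWitness[of _ ?h]) (use hg gh hc mod_homD(1)[OF hom] in auto)
  with hom show ?thesis by (simp add: mod_aut_def)
qed

text \<open>The automorphism keeps \<open>x\<close> in \<open>K\<close>, and subtracting
  \<open>x\<close> leaves the rank-one term. The square-zero case \<open>\<phi> v = \<zero>\<close>
  is always covered.\<close>

lemma aut_invariant_rank_one_unit:
  fixes R (structure) and M :: "('r, 'm) module"
  assumes mod: "module R M" and K: "submodule K R M" and aut: "\<And>g. g \<in> mod_aut R M \<Longrightarrow> g ` K \<subseteq> K"
    and \<phi>: "functional R M \<phi>" and v: "v \<in> carrier M" and u: "\<one> \<oplus> \<phi> v \<in> Units R"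
    and x: "x \<in> K"
  shows "\<phi> x \<odot>\<^bsub>M\<^esub> v \<in> K"
proof -
  interpret module R M by fact
  note E = submoduleE[OF K]
  have xc: "x \<in> carrier M" using x E(1) by auto
  have "x \<oplus>\<^bsub>M\<^esub> \<phi> x \<odot>\<^bsub>M\<^esub> v \<in> K" using aut[OF rank_one_mod_aut[OF mod \<phi> v u]] x by blast
  then have "\<ominus>\<^bsub>M\<^esub> x \<oplus>\<^bsub>M\<^esub> (x \<oplus>\<^bsub>M\<^esub> \<phi> x \<odot>\<^bsub>M\<^esub> v) \<in> K" using E(3,5) x by blast
  then show ?thesis using xc v functionalD(1)[OF \<phi> xc] by (simp add: M.r_neg1)
qed


lemma mod_hom_minus:
  assumes M: "module R M" and N: "module R N" and f: "f \<in> mod_hom R M N" and x: "x \<in> carrier M"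
  shows "f (\<ominus>\<^bsub>M\<^esub> x) = \<ominus>\<^bsub>N\<^esub> f x"
proof -
  interpret M: module R M by fact
  interpret N: module R N by fact
  note D = mod_homD[OF f]
  have "\<ominus>\<^bsub>M\<^esub> x = (\<ominus>\<^bsub>R\<^esub> \<one>\<^bsub>R\<^esub>) \<odot>\<^bsub>M\<^esub> x" using x by (simp add: M.smult_l_minus)
  then show ?thesis using D(1,3) x by (simp add: N.smult_l_minus)
qed

section \<open>Invariance under all endomorphisms\<close>

text \<open>Expanding \<open>q = p q\<close> in a dual basis and applying \<open>p\<close> to the
  generators writes \<open>q\<close> with coefficients in \<open>J\<close> and vectors in the image
  of \<open>p\<close>, so the T-nilpotent Nakayama lemma applies.\<close>

lemma projective_jacobson_summand_eq_zero:
  fixes P :: "('r, 'p) module"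
  assumes P: "projective_module R P" and T: "T_nilpotent R J" and J: "J \<subseteq> carrier R"
    and p: "p \<in> mod_hom R P P" and pp: "\<And>x. x \<in> carrier P \<Longrightarrow> p (p x) = p x"
    and pJ: "\<And>\<psi> x. functional R P \<psi> \<Longrightarrow> x \<in> carrier P \<Longrightarrow> \<psi> (p x) \<in> J"
    and x: "x \<in> carrier P"
  shows "p x = \<zero>\<^bsub>P\<^esub>"
proof -
  have mP: "module R P" using P by (simp add: projective_module_def)
  interpret module R P by fact
  obtain \<Phi> where \<Phi>: "\<And>y. functional R P (\<Phi> y)"
    and fin: "\<And>x. x \<in> carrier P \<Longrightarrow> finite {y. \<Phi> y x \<noteq> \<zero>\<^bsub>R\<^esub>}"
    and sub: "\<And>x. x \<in> carrier P \<Longrightarrow> {y. \<Phi> y x \<noteq> \<zero>\<^bsub>R\<^esub>} \<subseteq> carrier P"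
    and sum: "\<And>x. x \<in> carrier P \<Longrightarrow> (\<Oplus>\<^bsub>P\<^esub>y\<in>{y. \<Phi> y x \<noteq> \<zero>\<^bsub>R\<^esub>}. \<Phi> y x \<odot>\<^bsub>P\<^esub> y) = x"
    using projective_module_dual_basis[OF P] by blast
  note pD = mod_homD[OF p]
  show ?thesis
  proof (rule T_nilpotent_Nakayama[OF T J])
    show "p ` carrier P \<subseteq> carrier P" using pD(1) by blast
    show "p x \<in> p ` carrier P" using x by blast
    fix q assume "q \<in> p ` carrier P"
    then obtain z where z: "z \<in> carrier P" "q = p z" by blast
    have q: "q \<in> carrier P" "p q = q" using z pD(1) pp by auto
    let ?S = "{y. \<Phi> y q \<noteq> \<zero>\<^bsub>R\<^esub>}"
    have S: "y \<in> carrier P" if "y \<in> ?S" for y using sub[OF q(1)] that by blast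
    have c: "\<Phi> y q \<in> carrier R" for y using functionalD(1)[OF \<Phi> q(1)] .
    have "q = p (\<Oplus>\<^bsub>P\<^esub>y\<in>?S. \<Phi> y q \<odot>\<^bsub>P\<^esub> y)" unfolding sum[OF q(1)] q(2) ..
    also have "\<dots> = (\<Oplus>\<^bsub>P\<^esub>y\<in>?S. p (\<Phi> y q \<odot>\<^bsub>P\<^esub> y))"
      by (rule mod_hom_finsum[OF mP mP p fin[OF q(1)]]) (use c S in auto)
    also have "\<dots> = (\<Oplus>\<^bsub>P\<^esub>y\<in>?S. \<Phi> y q \<odot>\<^bsub>P\<^esub> p y)"
      by (rule M.finsum_cong') (use c S pD in auto)
    finally have "q = (\<Oplus>\<^bsub>P\<^esub>y\<in>?S. \<Phi> y q \<odot>\<^bsub>P\<^esub> p y)" .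
    moreover have "(\<lambda>y. \<Phi> y q) \<in> ?S \<rightarrow> J" using pJ[OF \<Phi> z(1)] z(2) by simp
    moreover have "p \<in> ?S \<rightarrow> p ` carrier P" using S by blast
    ultimately show "\<exists>S c u. finite S \<and> c \<in> S \<rightarrow> J \<and> u \<in> S \<rightarrow> p ` carrier P \<and>
        q = (\<Oplus>\<^bsub>P\<^esub>i\<in>(S :: 'p set). c i \<odot>\<^bsub>P\<^esub> u i)"
      using fin[OF q(1)] by (intro exI[of _ ?S] exI[of _ "\<lambda>y. \<Phi> y q"] exI[of _ p]) simp
  qed
qed

lemma aut_invariant_rank_one_local:
  fixes R (structure) and P :: "('r, 'p) module"
  assumes perf: "perfect_cring R" and P: "projective_module R P"
    and K: "submodule K R P" and aut: "\<And>g. g \<in> mod_aut R P \<Longrightarrow> g ` K \<subseteq> K"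
    and m: "maximalideal m R" and e: "e \<in> carrier R" "e \<otimes> e = e"
    and eJ: "\<And>r. r \<in> m \<Longrightarrow> e \<otimes> r \<in> jacobson_radical R"
    and \<phi>: "functional R P \<phi>" and v: "v \<in> carrier P" and x: "x \<in> K"
  shows "(e \<otimes> \<phi> x) \<odot>\<^bsub>P\<^esub> v \<in> K"
proof -
  have mP: "module R P" using P by (simp add: projective_module_def)
  interpret module R P by fact
  note E = submoduleE[OF K]
  note \<phi>D = functionalD[OF \<phi>]
  note unit = aut_invariant_rank_one_unit[OF mP K aut]
  have xc: "x \<in> carrier P" using x E(1) by blast
  have px: "\<phi> x \<in> carrier R" and pv: "\<phi> v \<in> carrier R" using \<phi>D(1) xc v by auto
  note inv = local_idempotent_invertible[OF m e eJ]
  show ?thesis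
  proof (cases "\<phi> v \<in> m")
    case True
    \<comment> \<open>This is \<open>e\<close> times \<open>\<phi>\<close>; the zero summand only
      matches the shape of \<open>functional_lincomb\<close>.\<close>
    let ?f = "\<lambda>x. e \<otimes> \<phi> x \<oplus> \<zero> \<otimes> \<phi> x"
    have f: "functional R P ?f" by (rule functional_lincomb[OF mP \<phi> \<phi> e(1)]) simp
    have "?f v = e \<otimes> \<phi> v" using e pv by simp
    then have "\<one> \<oplus> ?f v \<in> Units R" using R.one_plus_jacobson_radical_Units[OF eJ[OF True]] by simp
    from unit[OF _ f v this x] have "?f x \<odot>\<^bsub>P\<^esub> v \<in> K" .
    then show ?thesis using e px by simp
  next
    case False
    \<comment> \<open>Here \<open>s\<close> inverts \<open>\<phi> v\<close> inside
      \<open>eR\<close>.\<close>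
    then obtain s where s: "s \<in> carrier R" "e \<otimes> (\<phi> v \<otimes> s) = e" using inv pv by blast
    \<comment> \<open>\<open>?p\<close> is the projection of \<open>P\<close> onto \<open>eP \<inter> ker \<phi>\<close>.\<close>
    let ?p = "\<lambda>x. e \<odot>\<^bsub>P\<^esub> x \<oplus>\<^bsub>P\<^esub> (\<ominus> (e \<otimes> s \<otimes> \<phi> x)) \<odot>\<^bsub>P\<^esub> v"
    have p: "?p \<in> mod_hom R P P"
    proof (rule mod_homI)
      fix y assume y: "y \<in> carrier P"
      have py: "\<phi> y \<in> carrier R" using \<phi>D y by simp
      show "?p y \<in> carrier P" using e s py y v by simp
      show "?p (a \<odot>\<^bsub>P\<^esub> y) = a \<odot>\<^bsub>P\<^esub> ?p y" if a: "a \<in> carrier R" for a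
      proof -
        have "\<ominus> (e \<otimes> s \<otimes> (a \<otimes> \<phi> y)) = a \<otimes> (\<ominus> (e \<otimes> s \<otimes> \<phi> y))" using e(1) s(1) py a by algebra
        then show ?thesis
          using e s py y v a \<phi>D(3)[OF a y]
          by (simp add: smult_r_distr smult_assoc1[symmetric] R.m_comm)
      qed
      fix z assume z: "z \<in> carrier P"
      have pz: "\<phi> z \<in> carrier R" using \<phi>D z by simp
      have "\<ominus> (e \<otimes> s \<otimes> (\<phi> y \<oplus> \<phi> z)) = \<ominus> (e \<otimes> s \<otimes> \<phi> y) \<oplus> \<ominus> (e \<otimes> s \<otimes> \<phi> z)" using e(1) s(1) py pz by algebra
      then show "?p (y \<oplus>\<^bsub>P\<^esub> z) = ?p y \<oplus>\<^bsub>P\<^esub> ?p z"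
        using e s py pz y z v \<phi>D(2)[OF y z] by (simp add: smult_r_distr smult_l_distr M.a_ac)
    qed
    note pD = mod_homD[OF p]
    have \<phi>p: "\<phi> (?p y) = \<zero>" if y: "y \<in> carrier P" for y
    proof -
      have py: "\<phi> y \<in> carrier R" using \<phi>D y by simp
      have "\<phi> (?p y) = e \<otimes> \<phi> y \<oplus> (\<ominus> (e \<otimes> s \<otimes> \<phi> y)) \<otimes> \<phi> v"
        using \<phi>D e s py y v by simp
      also have "\<dots> = e \<otimes> \<phi> y \<ominus> (e \<otimes> (\<phi> v \<otimes> s)) \<otimes> \<phi> y" using e(1) s(1) py pv by algebra
      also have "\<dots> = \<zero>" unfolding s(2) using e py by (simp add: R.minus_eq R.r_neg)
      finally show ?thesis .
    qed
    have ep: "e \<odot>\<^bsub>P\<^esub> ?p y = ?p y" if y: "y \<in> carrier P" for y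
    proof -
      have py: "\<phi> y \<in> carrier R" using \<phi>D y by simp
      have "e \<otimes> (\<ominus> (e \<otimes> s \<otimes> \<phi> y)) = \<ominus> ((e \<otimes> e) \<otimes> s \<otimes> \<phi> y)" using e(1) s(1) py by algebra
      then show ?thesis
        using e s py y v by (simp add: smult_r_distr smult_assoc1[symmetric])
    qed
    \<comment> \<open>On the image of \<open>?p\<close>, \<open>\<phi>\<close> vanishes and
      \<open>e\<close> acts as the identity.\<close>
    have pp: "?p (?p y) = ?p y" if y: "y \<in> carrier P" for y
      using pD(1)[OF y] v e s by (simp only: \<phi>p[OF y] ep[OF y]) simp
    show ?thesis
    proof (cases "\<exists>y \<psi>. y \<in> carrier P \<and> functional R P \<psi> \<and> \<psi> (?p y) \<notin> m")
      case True
      then obtain y \<psi> where y: "y \<in> carrier P" and \<psi>: "functional R P \<psi>" and "\<psi> (?p y) \<notin> m" by blast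
      define q where "q = ?p y"
      have q: "q \<in> carrier P" "\<phi> q = \<zero>" "\<psi> q \<notin> m"
        unfolding q_def using pD(1)[OF y] \<phi>p[OF y] \<open>\<psi> (?p y) \<notin> m\<close> by auto
      note \<psi>D = functionalD[OF \<psi>]
      have c: "\<psi> q \<in> carrier R" "\<psi> v \<in> carrier R" using \<psi>D q v by auto
      obtain r where r: "r \<in> carrier R" "e \<otimes> (\<psi> q \<otimes> r) = e" using inv c q(3) by blast
      have qK: "\<phi> x \<odot>\<^bsub>P\<^esub> q \<in> K"
        by (rule unit[OF _ \<phi> q(1) _ x]) (simp_all add: q(2))
      \<comment> \<open>\<open>?f\<close> kills \<open>v\<close> and sends \<open>q\<close> to \<open>e\<close>, so \<open>e (v \<otimes> \<phi>)\<close> is the composite of the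
        square-zero maps \<open>v \<otimes> ?f\<close> and \<open>q \<otimes> \<phi>\<close>.\<close>
      let ?f = "\<lambda>x. (e \<otimes> r) \<otimes> \<psi> x \<oplus> (\<ominus> (e \<otimes> r \<otimes> s \<otimes> \<psi> v)) \<otimes> \<phi> x"
      have f: "functional R P ?f" by (rule functional_lincomb[OF mP \<psi> \<phi>]) (use e r s c in auto)
      have fq: "?f q = e" using e r s c q(2) R.m_comm[OF c(1) r(1)] by (simp add: R.m_assoc)
      \<comment> \<open>The second summand of \<open>?f\<close> was chosen to cancel the value of
        the first at \<open>v\<close>, using that \<open>s\<close> inverts \<open>\<phi> v\<close>
        in \<open>eR\<close>.\<close>
      have "?f v = r \<otimes> \<psi> v \<otimes> (e \<ominus> e \<otimes> (\<phi> v \<otimes> s))" using e(1) r(1) s(1) c pv by algebra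
      also have "\<dots> = \<zero>" unfolding s(2) using e r c by (simp add: R.minus_eq R.r_neg)
      finally have "\<one> \<oplus> ?f v \<in> Units R" by simp
      from unit[OF _ f v this qK] have "?f (\<phi> x \<odot>\<^bsub>P\<^esub> q) \<odot>\<^bsub>P\<^esub> v \<in> K" .
      moreover have "?f (\<phi> x \<odot>\<^bsub>P\<^esub> q) = e \<otimes> \<phi> x"
        using functionalD(3)[OF f px q(1)] fq e px R.m_comm by simp
      ultimately show ?thesis by simp
    next
      case False
      have J: "jacobson_radical R \<subseteq> carrier R" by (auto simp: jacobson_radical_def)
      have T: "T_nilpotent R (jacobson_radical R)" using perf by (simp add: perfect_cring_def)
      have pJ: "\<psi> (?p y) \<in> jacobson_radical R" if \<psi>: "functional R P \<psi>" and y: "y \<in> carrier P" for \<psi> y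
      proof -
        \<comment> \<open>In this case the value lies in \<open>m\<close>; inserting
          \<open>e\<close>, which fixes \<open>?p y\<close>, moves it into the radical.\<close>
        have "\<psi> (?p y) = \<psi> (e \<odot>\<^bsub>P\<^esub> ?p y)" unfolding ep[OF y] ..
        also have "\<dots> = e \<otimes> \<psi> (?p y)" by (rule functionalD(3)[OF \<psi> e(1) pD(1)[OF y]])
        finally show ?thesis using eJ False \<psi> y by metis
      qed
      have z: "?p x = \<zero>\<^bsub>P\<^esub>"
        by (rule projective_jacobson_summand_eq_zero[where p = ?p, OF P T J p])
          (erule pp, erule (1) pJ, rule xc)
      \<comment> \<open>Multiplying \<open>?p x\<close>, which is zero, by \<open>\<phi> v\<close>
        cancels \<open>s\<close>: the vector in question is a scalar multiple of \<open>x\<close>,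
        and every submodule absorbs scalars.\<close>
      have "\<phi> v \<odot>\<^bsub>P\<^esub> ?p x = (\<phi> v \<otimes> e) \<odot>\<^bsub>P\<^esub> x \<oplus>\<^bsub>P\<^esub> (\<phi> v \<otimes> (\<ominus> (e \<otimes> s \<otimes> \<phi> x))) \<odot>\<^bsub>P\<^esub> v"
        using e s px pv xc v by (simp add: smult_r_distr smult_assoc1)
      also have "\<phi> v \<otimes> (\<ominus> (e \<otimes> s \<otimes> \<phi> x)) = \<ominus> ((e \<otimes> (\<phi> v \<otimes> s)) \<otimes> \<phi> x)"
        using e(1) s(1) px pv by algebra
      also have "\<dots> = \<ominus> (e \<otimes> \<phi> x)" unfolding s(2) ..
      finally have "(\<phi> v \<otimes> e) \<odot>\<^bsub>P\<^esub> x \<oplus>\<^bsub>P\<^esub> (\<ominus> (e \<otimes> \<phi> x)) \<odot>\<^bsub>P\<^esub> v = \<zero>\<^bsub>P\<^esub>"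
        unfolding z using pv by simp
      then have "(\<phi> v \<otimes> e) \<odot>\<^bsub>P\<^esub> x = (e \<otimes> \<phi> x) \<odot>\<^bsub>P\<^esub> v"
        using e px pv xc v M.minus_equality[of "(\<phi> v \<otimes> e) \<odot>\<^bsub>P\<^esub> x" "(\<ominus> (e \<otimes> \<phi> x)) \<odot>\<^bsub>P\<^esub> v"]
        by (simp add: smult_l_minus)
      moreover have "(\<phi> v \<otimes> e) \<odot>\<^bsub>P\<^esub> x \<in> K" using E(4) x e pv by simp
      ultimately show ?thesis by simp
    qed
  qed
qed

lemma aut_invariant_rank_one:
  fixes R (structure) and P :: "('r, 'p) module"
  assumes perf: "perfect_cring R" and P: "projective_module R P"
    and K: "submodule K R P" and aut: "\<And>g. g \<in> mod_aut R P \<Longrightarrow> g ` K \<subseteq> K"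
    and \<phi>: "functional R P \<phi>" and v: "v \<in> carrier P" and x: "x \<in> K"
  shows "\<phi> x \<odot>\<^bsub>P\<^esub> v \<in> K"
proof -
  have mP: "module R P" using P by (simp add: projective_module_def)
  interpret module R P by fact
  note E = submoduleE[OF K]
  have xc: "x \<in> carrier P" using x E(1) by blast
  have px: "\<phi> x \<in> carrier R" using functionalD(1)[OF \<phi> xc] .
  let ?y = "\<phi> x \<odot>\<^bsub>P\<^esub> v"
  have y: "?y \<in> carrier P" using px v by simp
  \<comment> \<open>The annihilator of the class of \<open>?y\<close> modulo \<open>K\<close>; the
    goal is \<open>\<one> \<in> ?I\<close>.\<close>
  let ?I = "{r \<in> carrier R. r \<odot>\<^bsub>P\<^esub> ?y \<in> K}"
  have zero: "\<zero>\<^bsub>P\<^esub> \<in> K" using E(4)[OF R.zero_closed x] xc by simp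
  have I: "ideal ?I R"
  proof (rule idealI)
    show "ring R" by (rule R.ring_axioms)
    show "subgroup ?I (add_monoid R)"
    proof (rule R.add.subgroupI)
      show "?I \<noteq> {}" using zero y by (auto intro!: exI[of _ \<zero>])
    next
      fix a assume "a \<in> ?I"
      then show "\<ominus> a \<in> ?I" using E(3) y by (auto simp: smult_l_minus)
    next
      fix a b assume "a \<in> ?I" "b \<in> ?I"
      then show "a \<oplus> b \<in> ?I" using E(5) y by (auto simp: smult_l_distr)
    qed auto
    fix a b assume a: "a \<in> ?I" and b: "b \<in> carrier R"
    then have "b \<odot>\<^bsub>P\<^esub> (a \<odot>\<^bsub>P\<^esub> ?y) \<in> K" using E(4) by blast
    with a b y show "b \<otimes> a \<in> ?I" by (simp add: smult_assoc1)
    then show "a \<otimes> b \<in> ?I" using a b R.m_comm by simp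
  qed
  have "?I = carrier R"
  proof (rule ccontr)
    assume "?I \<noteq> carrier R"
    then obtain m where m: "maximalideal m R" "?I \<subseteq> m" using R.exists_maximalideal[OF I] by blast
    from R.perfect_cring_local_idempotent[OF perf m(1)] obtain e
      where e: "e \<in> carrier R" "e \<otimes> e = e" "e \<notin> m"
        and eJ: "\<And>r. r \<in> m \<Longrightarrow> e \<otimes> r \<in> jacobson_radical R" by blast
    have "(e \<otimes> \<phi> x) \<odot>\<^bsub>P\<^esub> v \<in> K"
      by (rule aut_invariant_rank_one_local[OF perf P K aut m(1) e(1,2) eJ \<phi> v x])
    then have "e \<in> ?I" using e px v by (simp add: smult_assoc1)
    with m(2) e(3) show False by blast
  qed
  then have "\<one> \<in> ?I" by simp
  then show ?thesis using y by simp
qed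

text \<open>On each \<open>x\<close> a dual basis writes \<open>f\<close> as a finite sum of
  rank-one maps, with functionals \<open>\<Phi> y\<close> and vectors \<open>f y\<close>.\<close>

lemma aut_invariant_imp_end_invariant:
  fixes R (structure) and P :: "('r, 'p) module"
  assumes perf: "perfect_cring R" and P: "projective_module R P"
    and K: "submodule K R P" and aut: "\<And>g. g \<in> mod_aut R P \<Longrightarrow> g ` K \<subseteq> K"
    and f: "f \<in> mod_hom R P P"
  shows "f ` K \<subseteq> K"
proof
  have mP: "module R P" using P by (simp add: projective_module_def)
  interpret module R P by fact
  obtain \<Phi> where \<Phi>: "\<And>y. functional R P (\<Phi> y)"
    and fin: "\<And>x. x \<in> carrier P \<Longrightarrow> finite {y. \<Phi> y x \<noteq> \<zero>\<^bsub>R\<^esub>}"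
    and sub: "\<And>x. x \<in> carrier P \<Longrightarrow> {y. \<Phi> y x \<noteq> \<zero>\<^bsub>R\<^esub>} \<subseteq> carrier P"
    and sum: "\<And>x. x \<in> carrier P \<Longrightarrow> (\<Oplus>\<^bsub>P\<^esub>y\<in>{y. \<Phi> y x \<noteq> \<zero>\<^bsub>R\<^esub>}. \<Phi> y x \<odot>\<^bsub>P\<^esub> y) = x"
    using projective_module_dual_basis[OF P] by blast
  fix z assume "z \<in> f ` K"
  then obtain x where x: "x \<in> K" "z = f x" by blast
  have xc: "x \<in> carrier P" using x submoduleE(1)[OF K] by blast
  let ?S = "{y. \<Phi> y x \<noteq> \<zero>\<^bsub>R\<^esub>}"
  have S: "y \<in> carrier P" if "y \<in> ?S" for y using sub[OF xc] that by blast
  have c: "\<Phi> y x \<in> carrier R" for y using functionalD(1)[OF \<Phi> xc] .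
  have "f x = f (\<Oplus>\<^bsub>P\<^esub>y\<in>?S. \<Phi> y x \<odot>\<^bsub>P\<^esub> y)" unfolding sum[OF xc] ..
  also have "\<dots> = (\<Oplus>\<^bsub>P\<^esub>y\<in>?S. f (\<Phi> y x \<odot>\<^bsub>P\<^esub> y))"
    by (rule mod_hom_finsum[OF mP mP f fin[OF xc]]) (use c S in auto)
  also have "\<dots> \<in> K"
  proof (rule finsum_mem_submodule[OF K fin[OF xc]])
    fix y assume "y \<in> ?S"
    then have y: "y \<in> carrier P" by (rule S)
    have "\<Phi> y x \<odot>\<^bsub>P\<^esub> f y \<in> K"
      by (rule aut_invariant_rank_one[OF perf P K aut \<Phi> mod_homD(1)[OF f y] x(1)])
    then show "f (\<Phi> y x \<odot>\<^bsub>P\<^esub> y) \<in> K" using mod_homD(3)[OF f c y] by simp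
  qed
  finally show "z \<in> K" using x(2) by simp
qed

section \<open>Descent along the projective cover\<close>

theorem theorem5p7:
  fixes R :: "('r, 's) ring_scheme"
    and M :: "('r, 'm) module"
    and P :: "('r, 'p) module"
    and \<pi> :: "'p \<Rightarrow> 'm"
  assumes "perfect_cring R"
    and "projective_cover R P \<pi> M"
    and "automorphism_coinvariant R P \<pi> M"
  shows "quasi_projective R P \<pi> M"
proof -
  have mM: "module R M" and P: "projective_module R P" and \<pi>: "\<pi> \<in> mod_hom R P M"
    and surj: "\<pi> ` carrier P = carrier M" and K: "submodule {x \<in> carrier P. \<pi> x = \<zero>\<^bsub>M\<^esub>} R P"
    using assms(2) by (auto simp: projective_cover_def mod_epi_def superfluous_submodule_def)
  have mP: "module R P" using P by (simp add: projective_module_def)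
  interpret P: module R P by fact
  interpret M: module R M by fact
  note \<pi>D = mod_homD[OF \<pi>]
  let ?K = "{x \<in> carrier P. \<pi> x = \<zero>\<^bsub>M\<^esub>}"
  have hom_zero: "f \<zero>\<^bsub>M\<^esub> = \<zero>\<^bsub>M\<^esub>" if f: "f \<in> mod_hom R M M" for f
    using mod_homD(3)[OF f P.R.zero_closed M.zero_closed] mod_homD(1)[OF f M.zero_closed] by simp
  have aut: "g ` ?K \<subseteq> ?K" if g: "g \<in> mod_aut R P" for g
  proof -
    obtain f where f: "f \<in> mod_hom R M M" "\<And>x. x \<in> carrier P \<Longrightarrow> \<pi> (g x) = f (\<pi> x)"
      using assms(3) g by (auto simp: automorphism_coinvariant_def)
    have "g \<in> mod_hom R P P" using g by (simp add: mod_aut_def)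
    then show ?thesis using f(2) hom_zero[OF f(1)] mod_homD(1) by fastforce
  qed
  show ?thesis
    unfolding quasi_projective_def
  proof
    fix g assume g: "g \<in> mod_hom R P P"
    note gD = mod_homD[OF g]
    have gK: "g ` ?K \<subseteq> ?K" by (rule aut_invariant_imp_end_invariant[OF assms(1) P K aut g])
    \<comment> \<open>Only a set-theoretic section of \<open>\<pi>\<close>; by \<open>wd\<close> the
      choice of preimages does not affect \<open>?f\<close>.\<close>
    let ?s = "inv_into (carrier P) \<pi>"
    have s: "?s y \<in> carrier P" "\<pi> (?s y) = y" if "y \<in> carrier M" for y
      using that inv_into_into[of y \<pi> "carrier P"] f_inv_into_f[of y \<pi> "carrier P"]
      unfolding surj by simp_all
    have wd: "\<pi> (g x) = \<pi> (g y)" if x: "x \<in> carrier P" and y: "y \<in> carrier P" and xy: "\<pi> x = \<pi> y" for x y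
    proof -
      let ?d = "x \<oplus>\<^bsub>P\<^esub> \<ominus>\<^bsub>P\<^esub> y"
      have d: "?d \<in> carrier P" using x y by simp
      have "\<pi> ?d = \<pi> x \<oplus>\<^bsub>M\<^esub> \<pi> (\<ominus>\<^bsub>P\<^esub> y)" by (rule \<pi>D(2)[OF x P.a_inv_closed[OF y]])
      also have "\<dots> = \<zero>\<^bsub>M\<^esub>"
        unfolding mod_hom_minus[OF mP mM \<pi> y] xy using \<pi>D(1)[OF y] by (rule M.r_neg)
      finally have "\<pi> (g ?d) = \<zero>\<^bsub>M\<^esub>" using gK d by blast
      moreover have "g ?d = g x \<oplus>\<^bsub>P\<^esub> \<ominus>\<^bsub>P\<^esub> g y"
        using gD(2)[OF x P.a_inv_closed[OF y]] mod_hom_minus[OF mP mP g y] by simp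
      moreover have "\<pi> (g x \<oplus>\<^bsub>P\<^esub> \<ominus>\<^bsub>P\<^esub> g y) = \<pi> (g x) \<oplus>\<^bsub>M\<^esub> \<ominus>\<^bsub>M\<^esub> \<pi> (g y)"
        using \<pi>D(2)[OF gD(1)[OF x] P.a_inv_closed[OF gD(1)[OF y]]]
          mod_hom_minus[OF mP mM \<pi> gD(1)[OF y]] by simp
      ultimately have "\<pi> (g x) \<oplus>\<^bsub>M\<^esub> \<ominus>\<^bsub>M\<^esub> \<pi> (g y) = \<zero>\<^bsub>M\<^esub>" by simp
      from M.minus_equality[OF this] show ?thesis using \<pi>D(1) gD(1) x y by simp
    qed
    let ?f = "\<lambda>y. \<pi> (g (?s y))"
    have fg: "\<pi> (g x) = ?f (\<pi> x)" if "x \<in> carrier P" for x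
      using wd[OF that s(1)] s(2) \<pi>D(1) that by simp
    have f: "?f \<in> mod_hom R M M"
    proof (rule mod_homI)
      fix y assume y: "y \<in> carrier M"
      show "?f y \<in> carrier M" using \<pi>D(1) gD(1) s(1) y by simp
      \<comment> \<open>Although \<open>?s\<close> need not be linear, \<open>a\<close> times
        \<open>?s y\<close> is a preimage of \<open>a\<close> times \<open>y\<close>, so
        \<open>fg\<close> evaluates \<open>?f\<close> there; sums are treated alike.\<close>
      show "?f (a \<odot>\<^bsub>M\<^esub> y) = a \<odot>\<^bsub>M\<^esub> ?f y" if "a \<in> carrier R" for a
        using fg[of "a \<odot>\<^bsub>P\<^esub> ?s y"] \<pi>D gD s y that by simp
      show "?f (y \<oplus>\<^bsub>M\<^esub> z) = ?f y \<oplus>\<^bsub>M\<^esub> ?f z" if "z \<in> carrier M" for z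
        using fg[of "?s y \<oplus>\<^bsub>P\<^esub> ?s z"] \<pi>D gD s y that by simp
    qed
    show "\<exists>f\<in>mod_hom R M M. \<forall>x\<in>carrier P. \<pi> (g x) = f (\<pi> x)"
      by (rule bexI[OF _ f]) (rule ballI, erule fg)
  qed
qed

end
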